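(* For $n\ge1$ let $P_n(q)=C_n(q)/(q-1)^2$ (a palindromic polynomial with integer coefficients of degree $2n-2$), and write $$P_n(q)=a_{n,0}\,q^{n-1}+\sum_{i=1}^{n-1}a_{n,i}\,(q^{n+i-1}+q^{n-i-1})$$ with integers $a_{n,i}$. Then for $n\ge1$ and $0\le i\le n-1$, the integer $a_{n,i}$ is equal to the number of positive divisors $d$ of $n$ satisfying $$\frac{i+\sqrt{2n+i^2}}{2}<d\le i+\sqrt{2n+i^2}.$$
   Context: For each integer $n\ge1$, the Laurent polynomial $C_n(q)$ is defined by the identity of formal power series in $t$ $$1+\sum_{n\ge1}\frac{C_n(q)}{q^n}t^n=\prod_{i\ge1}\frac{(1-t^i)^2}{1-(q+q^{-1})t^i+t^{2i}}.$$ It is known that $C_n(q)$ is a monic palindromic polynomial in $q$ with integer coefficients of degree $2n$ which is divisible by $(q-1)^2$; hence $P_n(q)=C_n(q)/(q-1)^2$ is a monic palindromic polynomial with integer coefficients of degree $2n-2$. *)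

theory Defs
  imports
    "HOL-Analysis.Infinite_Products"
    "HOL-Computational_Algebra.Polynomial"
    "HOL-Computational_Algebra.Fraction_Field"
    "HOL-Computational_Algebra.Formal_Power_Series"
begin

text \<open>
  Laurent polynomials in \<open>q\<close> with integer coefficients are regarded as elements of the field of
  rational functions \<open>\<rat>(q)\<close>, which is the type \<open>int poly fract\<close>.
\<close>

definition qvar :: "int poly fract" where
  "qvar = Fract [:0, 1:] 1"

text \<open>
  The product over \<open>i \<ge> 1\<close>, taken with respect to the library topology on formal power
  series, i.e. the \<open>t\<close>-adic one. The index of \<open>prodinf\<close> starts at \<open>0\<close>, hence the shift by
  \<open>Suc\<close>. Each denominator has constant term \<open>1\<close>, so the quotient is the usual one in the ring of
  power series. Here \<open>fps_X\<close> is the variable \<open>t\<close>.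
\<close>

definition gen_factor :: "nat \<Rightarrow> int poly fract fps" where
  "gen_factor i =
     (1 - fps_X ^ i)\<^sup>2 / (1 - fps_const (qvar + inverse qvar) * fps_X ^ i + fps_X ^ (2 * i))"

definition gen_prod :: "int poly fract fps" where
  "gen_prod = (\<Prod>i. gen_factor (Suc i))"

text \<open>
  \<open>C n\<close> is determined by the requirement that \<open>C n / q ^ n\<close> be the coefficient of \<open>t ^ n\<close>, for
  \<open>n \<ge> 1\<close>; the constant term of the product is \<open>1\<close>.
\<close>

definition C :: "nat \<Rightarrow> int poly fract" where
  "C n = qvar ^ n * fps_nth gen_prod n"

definition P :: "nat \<Rightarrow> int poly fract" where
  "P n = C n / (qvar - 1)\<^sup>2"

definition is_expansion :: "nat \<Rightarrow> (nat \<Rightarrow> int) \<Rightarrow> bool" where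
  "is_expansion n a \<longleftrightarrow>
     P n = of_int (a 0) * qvar ^ (n - 1)
         + (\<Sum>i = 1..n - 1. of_int (a i) * (qvar ^ (n + i - 1) + qvar ^ (n - i - 1)))"

end

theory Submission
  imports Defs "HOL-Computational_Algebra.Formal_Laurent_Series"
    "HOL-Computational_Algebra.Polynomial_Factorial"
begin

text \<open>
  Put \<open>u = q + 1/q\<close>, \<open>z = 2 - u = -(q - 1)\<^sup>2/q\<close> and \<open>D m = 1 - u t^m + t^(2m) = (1 - t^m)\<^sup>2 + z t^m\<close>.
  The product is a rational function of \<open>z\<close>, and its partial fraction expansion is the identity
  of the crank generating function
  \<open>1 + z (\<Sum>m\<ge>1. (-1)^m t^(m(m+1)/2) (1 + t^m) / D m)\<close>.
  Since \<open>(1 + x) / (1 - u x + x\<^sup>2)\<close> generates the sums of \<open>q^j\<close> over \<open>-k \<le> j \<le> k\<close>, the integer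
  \<open>a n i\<close> is the sum of \<open>(-1)^(m+1)\<close> over the \<open>m\<close> with \<open>2n = m (m + 1 + 2k)\<close> for some \<open>k \<ge> i\<close>.
  Exactly one of the two factors is odd. Let \<open>X = i + sqrt (2n + i\<^sup>2)\<close>. The odd \<open>m\<close> are the odd
  divisors of \<open>n\<close> for which the codivisor \<open>d = n/m\<close> has \<open>2d > X\<close>; the even \<open>m\<close> correspond to the odd
  divisors greater than \<open>X\<close>. The difference of the two counts is the number of odd divisors up
  to \<open>X\<close> minus the number of \<open>d \<le> X/2\<close> with \<open>n/d\<close> odd, and multiplication by 2 cancels the other
  divisors, which leaves those between \<open>X/2\<close> and \<open>X\<close>.
\<close>

unbundle no vec_syntax

section \<open>The finite partial fraction expansion\<close>

text \<open>
  For \<open>m \<le> N\<close> this is the quotient of the Gaussian binomial coefficients \<open>2N\<close> over \<open>N + m\<close> and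
  \<open>2N\<close> over \<open>N\<close>; it tends \<open>t\<close>-adically to \<open>1\<close> as \<open>N\<close> grows.
\<close>

definition qratio :: "'a::{comm_ring_1,inverse} \<Rightarrow> nat \<Rightarrow> nat \<Rightarrow> 'a" where
  "qratio t N m = (\<Prod>j<m. (1 - t ^ (N - j)) / (1 - t ^ Suc (N + j)))"

lemma qratio_0 [simp]: "qratio t N 0 = 1"
  by (simp add: qratio_def)

lemma qratio_Suc:
  "qratio (t :: 'a::field) N (Suc m) = qratio t N m * (1 - t ^ (N - m)) / (1 - t ^ Suc (N + m))"
  by (simp add: qratio_def)

text \<open>Raising \<open>N\<close> by one shifts both ranges of exponents by one, so only the end
  factors survive in the quotient. This relates the coefficients of consecutive expansions.\<close>

lemma qratio_Suc_left:
  assumes "\<And>i. i > 0 \<Longrightarrow> t ^ i \<noteq> 1" and "m \<le> N"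
  shows "qratio (t :: 'a::field) (Suc N) m =
    qratio t N m * (1 - t ^ Suc N)\<^sup>2 / ((1 - t ^ (Suc N - m)) * (1 - t ^ (Suc N + m)))"
  using assms(2)
proof (induction m)
  case 0
  have "1 - t ^ Suc N \<noteq> 0" using assms(1)[of "Suc N"] by simp
  then show ?case by (simp add: power2_eq_square)
next
  case (Suc m)
  have nz: "1 - t ^ (Suc N - m) \<noteq> 0" "1 - t ^ (N - m) \<noteq> 0" "1 - t ^ Suc (N + m) \<noteq> 0"
      "1 - t ^ Suc (Suc (N + m)) \<noteq> 0"
    using Suc.prems assms(1)[of "Suc N - m"] assms(1)[of "N - m"] assms(1)[of "Suc (N + m)"]
      assms(1)[of "Suc (Suc (N + m))"] by auto
  have e: "Suc N + m = Suc (N + m)" "Suc N - Suc m = N - m" "Suc N + Suc m = Suc (Suc (N + m))"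
    by auto
  show ?case
    unfolding qratio_Suc[of t "Suc N"] qratio_Suc[of t N] e Suc.IH[OF Suc_leD[OF Suc.prems]]
    using nz by (simp only: field_split_simps e) simp
qed

lemma triangle_Suc: "Suc m * (Suc m + 1) div 2 = m * (m + 1) div 2 + Suc m"
  by simp

text \<open>The closed form of the partial sums makes induction on \<open>M\<close> possible. The
  case of interest is \<open>M = N\<close>, where \<open>1 - t ^ (N - M)\<close> vanishes and the
  sum is -1.\<close>

lemma qratio_telescope:
  assumes "t ^ N \<noteq> (1::'a::field)" and nz: "\<And>i. i > 0 \<Longrightarrow> t ^ i \<noteq> 1" and "M \<le> N"
  shows "(\<Sum>m<M. (-1) ^ Suc m * t ^ (m * (m + 1) div 2) * (1 + t ^ Suc m) * qratio t N (Suc m))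
    = -1 + (-1) ^ M * t ^ (M * (M + 1) div 2) * qratio t N M * (1 - t ^ (N - M)) / (1 - t ^ N)"
  using assms(3)
proof (induction M)
  case 0
  then show ?case using assms(1) by simp
next
  case (Suc M)
  have n1: "1 - t ^ N \<noteq> 0" using assms(1) by simp
  have n2: "1 - t ^ Suc (N + M) \<noteq> 0" using nz[of "Suc (N + M)"] by simp
  \<comment> \<open>This removes truncated subtraction and turns all powers into monomials in
    \<open>t\<close>, \<open>x\<close>, \<open>y\<close>; the step becomes an identity of rational
    functions.\<close>
  obtain k where k: "N = k + Suc M" using Suc.prems by (metis le_add_diff_inverse2)
  have kk: "N - M = Suc k" "N - Suc M = k" using k by auto
  define x y where "x = t ^ M" and "y = t ^ k"
  have e: "t ^ N = y * (t * x)" "t ^ Suc k = t * y" "t ^ Suc M = t * x" "t ^ k = y"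
     "t ^ Suc (N + M) = t * (t * x * y) * x"
    by (simp_all add: k x_def y_def power_add algebra_simps)
  have IH: "(\<Sum>m<M. (-1) ^ Suc m * t ^ (m * (m + 1) div 2) * (1 + t ^ Suc m) * qratio t N (Suc m))
    = -1 + (-1) ^ M * t ^ (M * (M + 1) div 2) * qratio t N M * (1 - t ^ (N - M)) / (1 - t ^ N)"
    using Suc by simp
  define T Q where "T = (-1) ^ M * t ^ (M * (M + 1) div 2)" and "Q = qratio t N M"
  have T': "(-1) ^ Suc M * t ^ (M * (M + 1) div 2) = -T"
     "(-1) ^ Suc M * t ^ (Suc M * (Suc M + 1) div 2) = - T * (t * x)"
    unfolding T_def triangle_Suc by (simp_all add: power_add x_def)
  have "(\<Sum>m<Suc M. (-1) ^ Suc m * t ^ (m * (m + 1) div 2) * (1 + t ^ Suc m) * qratio t N (Suc m))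
    = -1 + T * Q * (1 - t * y) / (1 - y * (t * x))
      + (- T) * (1 + t * x) * (Q * (1 - t * y) / (1 - t * (t * x * y) * x))"
    unfolding sum.lessThan_Suc IH unfolding T' qratio_Suc kk e T_def[symmetric] Q_def[symmetric] ..
  also have "\<dots> = -1 + (- T * (t * x)) * (Q * (1 - t * y) / (1 - t * (t * x * y) * x)) * (1 - y) / (1 - y * (t * x))"
    using n1 n2 unfolding e by (simp add: divide_simps) algebra
  finally show ?case unfolding T' qratio_Suc kk e T_def[symmetric] Q_def[symmetric] .
qed

text \<open>
  In the step to \<open>N\<close>, each old term times the new factor splits over the two denominators because
  \<open>D N - D m t^(N-m) = (1 - t^(N-m)) (1 - t^(N+m))\<close>; the coefficients over the new denominator
  are collected by the telescoping sum.
\<close>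

lemma prod_eq_partial_fractions:
  fixes t z :: "'a::field"
  assumes nz: "\<And>i. i > 0 \<Longrightarrow> t ^ i \<noteq> 1"
    and nzD: "\<And>i. i > 0 \<Longrightarrow> (1 - t ^ i)\<^sup>2 + z * t ^ i \<noteq> 0"
  shows "(\<Prod>i<N. (1 - t ^ Suc i)\<^sup>2 / ((1 - t ^ Suc i)\<^sup>2 + z * t ^ Suc i)) =
    1 + z * (\<Sum>m<N. (-1) ^ Suc m * t ^ (Suc m * (Suc m + 1) div 2) * (1 + t ^ Suc m)
      * qratio t N (Suc m) / ((1 - t ^ Suc m)\<^sup>2 + z * t ^ Suc m))"
proof (induction N)
  case 0
  then show ?case by simp
next
  case (Suc N)
  define D where "D m = (1 - t ^ m)\<^sup>2 + z * t ^ m" for m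
  define c where "c N m = (-1) ^ Suc m * t ^ (Suc m * (Suc m + 1) div 2) * (1 + t ^ Suc m)
      * qratio t N (Suc m)" for N m
  define a where "a = (1 - t ^ Suc N)\<^sup>2"
  have D_nz: "D (Suc m) \<noteq> 0" for m
    using nzD[of "Suc m"] by (simp add: D_def)
  have IH: "(\<Prod>i<N. (1 - t ^ Suc i)\<^sup>2 / D (Suc i)) = 1 + z * (\<Sum>m<N. c N m / D (Suc m))"
    using Suc.IH unfolding D_def c_def .
  have split: "c N m / D (Suc m) * (a / D (Suc N)) =
      c (Suc N) m / D (Suc m) - c (Suc N) m * t ^ (N - m) / D (Suc N)" if "m < N" for m
  proof -
    obtain k where "N = Suc (m + k)" using less_imp_Suc_add[OF \<open>m < N\<close>] by blast
    then have k: "N = k + Suc m" by simp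
    define x y where "x = t ^ Suc m" and "y = t ^ Suc k"
    have e: "N - m = Suc k" "Suc N - Suc m = Suc k" using k by auto
    have tN: "t ^ Suc N = x * y" "t ^ (Suc N + Suc m) = x * x * y"
      by (simp_all add: k x_def y_def power_add algebra_simps)
    have n: "1 - y \<noteq> 0" "1 - x * x * y \<noteq> 0"
      using nz[of "Suc k"] nz[of "Suc N + Suc m"] unfolding y_def tN by auto
    have c: "c (Suc N) m * ((1 - y) * (1 - x * x * y)) = c N m * a"
      using n that qratio_Suc_left[OF nz, of "Suc m" N] unfolding c_def a_def e tN y_def[symmetric]
      by simp
    have eq: "D (Suc N) - D (Suc m) * y = (1 - y) * (1 - x * x * y)"
      unfolding D_def tN x_def[symmetric] by (simp add: power2_eq_square algebra_simps)
    have "c (Suc N) m * (D (Suc N) - D (Suc m) * y) = c N m * a"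
      using c unfolding eq .
    then show ?thesis
      using D_nz[of m] D_nz[of N] unfolding e y_def[symmetric] by (simp add: field_simps)
  qed
  have nzN: "t ^ Suc N \<noteq> 1" using nz[of "Suc N"] by simp
  \<comment> \<open>With triangular numbers T(m) = m(m+1)/2 one has T(m+1) + (N - m) = (N + 1) +
    T(m), so this is t^(N+1) times the telescoping sum.\<close>
  have "(\<Sum>m<Suc N. c (Suc N) m * t ^ (N - m)) =
      (\<Sum>m<Suc N. t ^ Suc N * ((-1) ^ Suc m * t ^ (m * (m + 1) div 2) * (1 + t ^ Suc m)
        * qratio t (Suc N) (Suc m)))"
  proof (rule sum.cong[OF refl])
    fix m assume "m \<in> {..<Suc N}"
    then have "m * (m + 1) div 2 + Suc m + (N - m) = Suc N + m * (m + 1) div 2"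
      by simp
    then have *: "t ^ (m * (m + 1) div 2 + Suc m) * t ^ (N - m) = t ^ Suc N * t ^ (m * (m + 1) div 2)"
      by (metis power_add)
    have "c (Suc N) m * t ^ (N - m) = (-1) ^ Suc m * (t ^ (m * (m + 1) div 2 + Suc m) * t ^ (N - m))
        * (1 + t ^ Suc m) * qratio t (Suc N) (Suc m)"
      unfolding c_def triangle_Suc by (simp only: mult_ac)
    then show "c (Suc N) m * t ^ (N - m) = t ^ Suc N * ((-1) ^ Suc m * t ^ (m * (m + 1) div 2)
        * (1 + t ^ Suc m) * qratio t (Suc N) (Suc m))"
      unfolding * by (simp only: mult_ac)
  qed
  also have "\<dots> = t ^ Suc N * (\<Sum>m<Suc N. (-1) ^ Suc m * t ^ (m * (m + 1) div 2) * (1 + t ^ Suc m)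
        * qratio t (Suc N) (Suc m))"
    by (rule sum_distrib_left[symmetric])
  also have "\<dots> = t ^ Suc N * - 1"
    by (subst qratio_telescope[OF nzN nz order_refl]) simp_all
  finally have sum0: "(\<Sum>m<N. c (Suc N) m * t ^ (N - m)) = - (t ^ Suc N) - c (Suc N) N"
    by (simp only: sum.lessThan_Suc diff_self_eq_0 power_0 mult_1_right mult_minus_right eq_diff_eq)
  have "(\<Prod>i<Suc N. (1 - t ^ Suc i)\<^sup>2 / D (Suc i)) =
      a / D (Suc N) + z * (\<Sum>m<N. c N m / D (Suc m) * (a / D (Suc N)))"
    unfolding prod.lessThan_Suc IH a_def[symmetric] sum_distrib_right[symmetric]
    by (simp only: distrib_right mult_1_left mult.assoc)
  also have "(\<Sum>m<N. c N m / D (Suc m) * (a / D (Suc N))) =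
      (\<Sum>m<N. c (Suc N) m / D (Suc m)) - (\<Sum>m<N. c (Suc N) m * t ^ (N - m)) / D (Suc N)"
    unfolding sum_divide_distrib sum_subtractf[symmetric]
    by (rule sum.cong[OF refl], rule split) simp
  \<comment> \<open>The correction cancels against \<open>- (t ^ Suc N)\<close> in
    \<open>sum0\<close>, which leaves \<open>c (Suc N) N\<close> over the new denominator.\<close>
  also have "a / D (Suc N) = 1 - z * t ^ Suc N / D (Suc N)"
    using D_nz[of N] by (simp add: divide_simps) (simp add: D_def a_def)
  also have "1 - z * t ^ Suc N / D (Suc N) + z * ((\<Sum>m<N. c (Suc N) m / D (Suc m))
        - (\<Sum>m<N. c (Suc N) m * t ^ (N - m)) / D (Suc N))
      = 1 + z * (\<Sum>m<Suc N. c (Suc N) m / D (Suc m))"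
    unfolding sum0 sum.lessThan_Suc using D_nz[of N] by (simp add: field_simps)
  finally show ?case unfolding D_def c_def .
qed

section \<open>Coefficients of the product\<close>

definition crank_den :: "'a::field \<Rightarrow> nat \<Rightarrow> 'a fps" where
  "crank_den u i = 1 - fps_const u * fps_X ^ i + fps_X ^ (2 * i)"

lemma crank_den_nth_0: "i > 0 \<Longrightarrow> crank_den u i $ 0 = 1"
  by (simp add: crank_den_def)

lemma crank_den_eq: "crank_den u i = (1 - fps_X ^ i)\<^sup>2 + fps_const (2 - u) * fps_X ^ i"
proof -
  have "fps_const (2 - u) = 2 - fps_const u"
    by (simp add: numeral_fps_const)
  moreover have "1 - c * x + x * x = (1 - x) * (1 - x) + (2 - c) * x" for c x :: "'a fps"
    by algebra
  ultimately show ?thesis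
    unfolding crank_den_def mult_2 power_add power2_eq_square by metis
qed

section \<open>Transfer of the expansion to formal power series\<close>

lemma fps_to_fls_prod: "fps_to_fls (\<Prod>i\<in>A. f i) = (\<Prod>i\<in>A. fps_to_fls (f i :: 'a::comm_ring_1 fps))"
  by (induction A rule: infinite_finite_induct) (simp_all add: fls_times_fps_to_fls)

lemma fps_to_fls_sum: "fps_to_fls (\<Sum>i\<in>A. f i) = (\<Sum>i\<in>A. fps_to_fls (f i :: 'a::comm_ring_1 fps))"
  by (induction A rule: infinite_finite_induct) simp_all

lemma fps_to_fls_divide_unit:
  "g $ 0 \<noteq> 0 \<Longrightarrow> fps_to_fls (f / g :: 'a::field fps) = fps_to_fls f / fps_to_fls g"
  using fls_divide_fps_to_fls[of g f] by (simp add: subdegree_eq_0)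

lemma fps_to_fls_qratio:
  "fps_to_fls (qratio fps_X N m) = qratio (fls_X :: 'a::field fls) N m"
  unfolding qratio_def fps_to_fls_prod
  by (intro prod.cong refl) (subst fps_to_fls_divide_unit, auto simp: fps_to_fls_power fls_times_fps_to_fls)

text \<open>The expansion needs a field, so it is applied at \<open>fls_X\<close> in the Laurent
  series and pulled back along the injective \<open>fps_to_fls\<close>, which respects these
  quotients because the denominators have nonzero constant term.\<close>

lemma crank_prod_eq_partial_fractions:
  fixes u :: "'a::field"
  shows "(\<Prod>i<N. (1 - fps_X ^ Suc i)\<^sup>2 / crank_den u (Suc i)) =
    1 + fps_const (2 - u) * (\<Sum>m<N. (-1) ^ Suc m * fps_X ^ (Suc m * (Suc m + 1) div 2)
      * (1 + fps_X ^ Suc m) * qratio fps_X N (Suc m) / crank_den u (Suc m))"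
proof -
  have X: "fls_X ^ i \<noteq> (1::'a fls)" if "i > 0" for i
  proof -
    have "fps_X ^ i $ 0 \<noteq> (1::'a fps) $ 0" using that by simp
    then have "fps_to_fls (fps_X ^ i) \<noteq> (1::'a fls)"
      unfolding fps_to_fls_eq_1_iff by metis
    then show ?thesis by (simp add: fps_to_fls_power)
  qed
  have D: "fps_to_fls (crank_den u i) = (1 - fls_X ^ i)\<^sup>2 + fls_const (2 - u) * fls_X ^ i" for i
    unfolding crank_den_eq by (simp add: fps_to_fls_power fls_times_fps_to_fls)
  have nzD: "(1 - fls_X ^ i)\<^sup>2 + fls_const (2 - u) * fls_X ^ i \<noteq> 0" if "i > 0" for i
  proof -
    have "crank_den u i \<noteq> 0" using crank_den_nth_0[OF that, of u] by auto
    then show ?thesis unfolding D[symmetric] by simp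
  qed
  have dz: "crank_den u (Suc i) $ 0 \<noteq> 0" for i
    by (simp add: crank_den_nth_0)
  show ?thesis
    using prod_eq_partial_fractions[OF X nzD, of N]
    unfolding fps_to_fls_eq_iff[symmetric] D[symmetric] fps_to_fls_plus fls_times_fps_to_fls
      fps_to_fls_prod fps_to_fls_sum fps_to_fls_divide_unit[OF dz] fps_to_fls_qratio
      fps_to_fls_power fps_to_fls_minus fps_to_fls_uminus fps_one_to_fls fps_X_to_fls fps_const_to_fls .
qed

section \<open>Congruences modulo powers of t and stability of coefficients\<close>

lemma fps_X_power_dvd_nth_eq_0:
  fixes f :: "'a::comm_ring_1 fps"
  assumes "fps_X ^ k dvd f" "n < k"
  shows "f $ n = 0"
  using assms by (auto elim!: dvdE simp: fps_X_power_mult_nth)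

lemma dvd_mult_minus_1:
  fixes d :: "'a::comm_ring_1"
  assumes "d dvd f - 1" "d dvd g - 1"
  shows "d dvd f * g - 1"
proof -
  have "f * g - 1 = (f - 1) * g + (g - 1)" by (simp add: algebra_simps)
  then show ?thesis using assms by (metis dvd_add dvd_mult2)
qed

lemma dvd_divide_minus_1:
  fixes f g :: "'a::field fps"
  assumes "g $ 0 \<noteq> 0" "d dvd f - g"
  shows "d dvd f / g - 1"
proof -
  have "f / g - 1 = (f - g) * inverse g"
    using assms(1) inverse_mult_eq_1'[of g] by (simp add: fps_divide_unit algebra_simps)
  then show ?thesis using assms(2) by simp
qed

text \<open>The factor with index \<open>j\<close> is congruent to 1 modulo t^(N-j), and here j <=
  m. This makes the limit 1 of \<open>qratio\<close> quantitative.\<close>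

lemma fps_X_power_dvd_qratio_minus_1:
  assumes "m \<le> N"
  shows "fps_X ^ (N - m) dvd qratio (fps_X :: 'a::field fps) N (Suc m) - 1"
  using assms
proof (induction m)
  case 0
  have e: "qratio (fps_X :: 'a fps) N (Suc 0) = (1 - fps_X ^ N) / (1 - fps_X ^ Suc N)"
    unfolding qratio_def by simp
  show ?case unfolding e
    by (rule dvd_divide_minus_1) (auto simp: dvd_diff)
next
  case (Suc m)
  have "qratio (fps_X :: 'a fps) N (Suc (Suc m)) = qratio fps_X N (Suc m)
     * ((1 - fps_X ^ (N - Suc m)) / (1 - fps_X ^ Suc (N + Suc m)))"
    unfolding qratio_def by simp
  moreover have "fps_X ^ (N - Suc m) dvd (fps_X :: 'a fps) ^ (N - m)"
    by (simp add: le_imp_power_dvd)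
  moreover have "fps_X ^ (N - Suc m) dvd
     (1 - fps_X ^ (N - Suc m)) / (1 - fps_X ^ Suc (N + Suc m)) - (1 :: 'a fps)"
    by (intro dvd_divide_minus_1) (auto simp: le_imp_power_dvd dvd_diff simp del: power_Suc)
  ultimately show ?case
    using Suc by (auto intro!: dvd_mult_minus_1 intro: dvd_trans)
qed

lemma fps_X_power_dvd_crank_factor_minus_1:
  assumes "i > 0"
  shows "fps_X ^ i dvd (1 - fps_X ^ i)\<^sup>2 / crank_den u i - 1"
  by (rule dvd_divide_minus_1) (use assms in \<open>simp_all add: crank_den_nth_0, simp add: crank_den_eq\<close>)

text \<open>Factors beyond the first \<open>n\<close> are congruent to 1 modulo t^(n+1).\<close>

lemma crank_prod_nth_stable:
  assumes "n \<le> N"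
  shows "(\<Prod>i<N. (1 - fps_X ^ Suc i)\<^sup>2 / crank_den u (Suc i)) $ n =
    (\<Prod>i<n. (1 - fps_X ^ Suc i)\<^sup>2 / crank_den u (Suc i)) $ n"
  using assms
proof (induction N rule: dec_induct)
  case (step N)
  define Q where "Q = (\<Prod>i<N. (1 - fps_X ^ Suc i)\<^sup>2 / crank_den u (Suc i))"
  define f where "f = (1 - fps_X ^ Suc N)\<^sup>2 / crank_den u (Suc N)"
  have dvd: "fps_X ^ Suc N dvd Q * (f - 1)"
    unfolding f_def by (rule dvd_mult, rule fps_X_power_dvd_crank_factor_minus_1) simp
  have "n < Suc N"
    using step.hyps by simp
  from fps_X_power_dvd_nth_eq_0[OF dvd this] have "(Q * (f - 1)) $ n = 0" .
  then have "(Q * f) $ n = Q $ n" by (simp add: right_diff_distrib)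
  then show ?case using step.IH unfolding prod.lessThan_Suc Q_def f_def by simp
qed simp

section \<open>Symmetric sums of powers of q and their generating function\<close>

fun sym_sum :: "'a::field \<Rightarrow> nat \<Rightarrow> 'a" where
  "sym_sum q 0 = 1"
| "sym_sum q (Suc k) = sym_sum q k + q ^ Suc k + inverse q ^ Suc k"

text \<open>Both q^k and q^(-k) satisfy x(k+2) = u x(k+1) - x(k) with u = q + 1/q, hence so do the
  increments of \<open>sym_sum\<close>. The left side is therefore independent of \<open>k\<close>,
  and it vanishes at \<open>k = 0\<close>.\<close>

lemma sym_sum_recurrence:
  assumes "q \<noteq> 0"
  shows "sym_sum q (Suc (Suc k)) - (q + inverse q) * sym_sum q (Suc k) + sym_sum q k = 0"
proof (induction k)
  case 0
  show ?case using assms by (simp add: field_simps power2_eq_square)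
next
  case (Suc k)
  define r a b where "r = inverse q" and "a = q ^ k" and "b = r ^ k"
  have r: "q * r = 1" using assms by (simp add: r_def)
  have "q * (q * (q * a)) + r * (r * (r * b))
      = (q + r) * (q * (q * a) + r * (r * b)) - (q * r) * (q * a + r * b)"
    by (simp add: algebra_simps)
  then have *: "q ^ Suc (Suc (Suc k)) + r ^ Suc (Suc (Suc k))
      = (q + r) * (q ^ Suc (Suc k) + r ^ Suc (Suc k)) - (q ^ Suc k + r ^ Suc k)"
    unfolding r by (simp add: a_def b_def)
  have step: "sym_sum q (Suc k) = sym_sum q k + (q ^ Suc k + r ^ Suc k)" for k
    by (simp add: r_def)
  have "sym_sum q (Suc (Suc (Suc k))) - (q + r) * sym_sum q (Suc (Suc k)) + sym_sum q (Suc k)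
      = sym_sum q (Suc (Suc k)) - (q + r) * sym_sum q (Suc k) + sym_sum q k"
    unfolding step[of "Suc (Suc k)"] * step[of "Suc k"] distrib_left
    using step[of k] by (simp del: sym_sum.simps power_Suc)
  then show ?case using Suc.IH unfolding r_def by (simp only:)
qed

lemma sym_sum_generating_function:
  fixes q :: "'a::field"
  assumes "q \<noteq> 0"
  shows "Abs_fps (sym_sum q) * crank_den (q + inverse q) 1 = 1 + fps_X"
proof (rule fps_ext)
  fix n
  have e: "Abs_fps (sym_sum q) * crank_den (q + inverse q) 1 = Abs_fps (sym_sum q)
     - fps_const (q + inverse q) * (fps_X * Abs_fps (sym_sum q)) + fps_X * (fps_X * Abs_fps (sym_sum q))"
    by (simp add: crank_den_def power2_eq_square algebra_simps)
  consider "n = 0" | "n = 1" | k where "n = Suc (Suc k)"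
    using not0_implies_Suc by (metis One_nat_def)
  then show "(Abs_fps (sym_sum q) * crank_den (q + inverse q) 1) $ n = (1 + fps_X) $ n"
  proof cases
    case 3
    then show ?thesis unfolding e using sym_sum_recurrence[OF assms, of k]
      by (simp add: fps_X_power_mult_nth del: sym_sum.simps)
  qed (unfold e, simp_all)
qed

text \<open>Substitution of t^m, which has no constant term, into the generating function.\<close>

lemma crank_den_quotient:
  fixes q :: "'a::field"
  assumes "q \<noteq> 0" "m > 0"
  shows "(1 + fps_X ^ m) / crank_den (q + inverse q) m = Abs_fps (sym_sum q) oo fps_X ^ m"
proof -
  let ?u = "q + inverse q"
  have X: "(fps_X ^ m :: 'a fps) $ 0 = 0" using assms by simp
  have "crank_den ?u 1 oo fps_X ^ m = crank_den ?u m"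
    using assms unfolding crank_den_def
    by (simp add: fps_compose_add_distrib fps_compose_sub_distrib fps_compose_mult_distrib[OF X]
       fps_compose_power[OF X, symmetric] power_mult[symmetric] mult.commute
       del: fps_const_add)
  moreover have "(1 + fps_X) oo fps_X ^ m = (1 + fps_X ^ m :: 'a fps)"
    using assms by (simp add: fps_compose_add_distrib)
  ultimately have "(Abs_fps (sym_sum q) oo fps_X ^ m) * crank_den ?u m = 1 + fps_X ^ m"
    using sym_sum_generating_function[OF assms(1)] fps_compose_mult_distrib[OF X] by metis
  moreover have "crank_den ?u m \<noteq> 0" using crank_den_nth_0[OF assms(2), of ?u] by auto
  ultimately show ?thesis by (metis nonzero_mult_div_cancel_right)
qed

text \<open>
  Since \<open>m (m + 1) / 2 \<ge> m\<close>, the product over \<open>i \<le> n\<close> already has the coefficient of \<open>t^n\<close> that one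
  gets with \<open>qratio\<close> replaced by its limit \<open>1\<close>.
\<close>

lemma crank_prod_nth:
  fixes q :: "'a::field"
  assumes "q \<noteq> 0" "n > 0"
  defines "u \<equiv> q + inverse q"
  shows "(\<Prod>i<n. (1 - fps_X ^ Suc i)\<^sup>2 / crank_den u (Suc i)) $ n =
    (2 - u) * (\<Sum>m<n. let T = Suc m * (Suc m + 1) div 2 in
      if T \<le> n \<and> Suc m dvd n - T then (-1) ^ Suc m * sym_sum q ((n - T) div Suc m) else 0)"
proof -
  have "((-1) ^ Suc m * fps_X ^ T * (1 + fps_X ^ Suc m) * qratio fps_X n (Suc m) / crank_den u (Suc m)) $ n
     = (if T \<le> n \<and> Suc m dvd n - T then (-1) ^ Suc m * sym_sum q ((n - T) div Suc m) else 0)"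
    if "m < n" and T: "T = Suc m * (Suc m + 1) div 2" for m T
  proof -
    have dz: "crank_den u (Suc m) $ 0 \<noteq> 0"
      by (simp add: crank_den_nth_0)
    define A :: "'a fps" where "A = Abs_fps (sym_sum q) oo fps_X ^ Suc m"
    define R :: "'a fps" where "R = qratio fps_X n (Suc m)"
    have "(-1) ^ Suc m * fps_X ^ T * (1 + fps_X ^ Suc m) * R / crank_den u (Suc m)
      = (-1) ^ Suc m * fps_X ^ T * R * ((1 + fps_X ^ Suc m) / crank_den u (Suc m))"
      unfolding fps_divide_unit[OF dz] by (simp only: mult_ac)
    also have "(1 + fps_X ^ Suc m) / crank_den u (Suc m) = A"
      unfolding u_def A_def by (rule crank_den_quotient) (use assms in auto)
    \<comment> \<open>\<open>R\<close> is split into its limit 1 and the error \<open>R - 1\<close>.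
      The error part is divisible by t^(T + n - m) with T > m, so it does not reach degree
      \<open>n\<close>.\<close>
    also have "(-1) ^ Suc m * fps_X ^ T * R * A =
        (-1) ^ Suc m * A * (fps_X ^ T * (R - 1)) + fps_const ((-1) ^ Suc m) * (fps_X ^ T * A)"
      by (simp add: algebra_simps fps_const_power[symmetric] fps_const_neg[symmetric] del: fps_const_power fps_const_neg)
    finally have e: "(-1) ^ Suc m * fps_X ^ T * (1 + fps_X ^ Suc m) * R / crank_den u (Suc m)
       = (-1) ^ Suc m * A * (fps_X ^ T * (R - 1)) + fps_const ((-1) ^ Suc m) * (fps_X ^ T * A)" .
    have "m < T" unfolding T by simp
    then have "n < T + (n - m)" using that by simp
    have "fps_X ^ (n - m) dvd R - 1"
      unfolding R_def using that by (intro fps_X_power_dvd_qratio_minus_1) simp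
    then have "fps_X ^ (T + (n - m)) dvd (-1) ^ Suc m * A * (fps_X ^ T * (R - 1))"
      unfolding power_add by (intro dvd_mult mult_dvd_mono) simp_all
    from fps_X_power_dvd_nth_eq_0[OF this \<open>n < T + (n - m)\<close>] show ?thesis
      unfolding R_def[symmetric] e
      by (simp add: fps_X_power_mult_nth A_def fps_nth_compose_X_power not_le del: power_Suc)
  qed
  then have "(\<Sum>m<n. (-1) ^ Suc m * fps_X ^ (Suc m * (Suc m + 1) div 2)
      * (1 + fps_X ^ Suc m) * qratio fps_X n (Suc m) / crank_den u (Suc m)) $ n
    = (\<Sum>m<n. let T = Suc m * (Suc m + 1) div 2 in
      if T \<le> n \<and> Suc m dvd n - T then (-1) ^ Suc m * sym_sum q ((n - T) div Suc m) else 0)"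
    unfolding fps_sum_nth Let_def by (intro sum.cong refl) (simp only: lessThan_iff)
  moreover have "(1 :: 'a fps) $ n = 0"
    using assms(2) by simp
  ultimately show ?thesis
    unfolding crank_prod_eq_partial_fractions fps_add_nth fps_mult_left_const_nth
    by (simp only: add_0_left)
qed

section \<open>The infinite product as a t-adic limit\<close>

lemma gen_factor_eq: "gen_factor i = (1 - fps_X ^ i)\<^sup>2 / crank_den (qvar + inverse qvar) i"
  unfolding gen_factor_def crank_den_def ..

text \<open>Each coefficient of the partial products is eventually constant, so the diagonal series
  \<open>p\<close> is their limit.\<close>

lemma gen_prod_nth: "gen_prod $ n = (\<Prod>i<n. gen_factor (Suc i)) $ n"
proof -
  define p where "p = Abs_fps (\<lambda>n. (\<Prod>i<n. gen_factor (Suc i)) $ n)"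
  have stable: "(\<Prod>i<N. gen_factor (Suc i)) $ n = p $ n" if "n \<le> N" for n N
    using crank_prod_nth_stable[OF that, of "qvar + inverse qvar"] by (simp add: gen_factor_eq p_def)
  have "(\<lambda>N. \<Prod>i\<le>N. gen_factor (Suc i)) \<longlonglongrightarrow> p"
  proof (rule tendsto_fpsI)
    fix n
    show "\<forall>\<^sub>F N in sequentially. (\<Prod>i\<le>N. gen_factor (Suc i)) $ n = p $ n"
      using eventually_ge_at_top[of n]
      by eventually_elim (simp add: lessThan_Suc_atMost[symmetric] stable del: prod.lessThan_Suc)
  qed
  \<comment> \<open>\<open>raw_has_prod\<close> demands a nonzero limit; the constant term of
    \<open>p\<close> comes from the empty product.\<close>
  moreover have "p \<noteq> 0"
  proof -
    have "p $ 0 = 1" by (simp add: p_def)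
    then show ?thesis by auto
  qed
  ultimately have "(\<lambda>i. gen_factor (Suc i)) has_prod p"
    by (simp add: has_prod_def raw_has_prod_def)
  then have "gen_prod = p"
    unfolding gen_prod_def by (rule has_prod_unique[symmetric])
  then show ?thesis using stable[of n n] by simp
qed

section \<open>Laurent polynomials in q and the coefficients of P_n\<close>

lemma qvar_eq: "qvar = to_fract [:0, 1:]"
  by (simp add: qvar_def to_fract_def)

lemma qvar_power: "qvar ^ k = to_fract (monom 1 k)"
proof (induction k)
  case (Suc k)
  then show ?case by (simp add: qvar_eq monom_Suc flip: to_fract_mult)
qed (simp add: monom_0 one_pCons flip: to_fract_1)

lemma of_int_eq_to_fract: "(of_int c :: int poly fract) = to_fract [:c:]"
proof -
  have "(of_nat k :: int poly fract) = to_fract [:int k:]" for k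
    by (induction k) (simp_all add: one_pCons flip: to_fract_1 to_fract_add)
  moreover have "[:- 1 - int k:] = - 1 - [:int k:]" for k
    by (simp add: one_pCons)
  ultimately show ?thesis
    by (cases c) simp_all
qed

lemma qvar_neq_0_1: "qvar \<noteq> 0" "qvar \<noteq> 1"
  by (simp_all add: qvar_eq one_pCons flip: to_fract_1)

text \<open>The summand of \<open>m\<close> belongs to index m + 1 of the crank expansion; its sign
  (-1)^(m+1) is reversed by 2 - u = -(q - 1)^2/q. The bound on \<open>i\<close> says that q^i occurs
  in the symmetric sum.\<close>

definition crank_coeff :: "nat \<Rightarrow> nat \<Rightarrow> int" where
  "crank_coeff n i = (\<Sum>m<n. let T = Suc m * (Suc m + 1) div 2 in
     if T \<le> n \<and> Suc m dvd n - T \<and> i \<le> (n - T) div Suc m then (-1) ^ m else 0)"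

text \<open>The prefactor 2 - u = -(q - 1)^2/q cancels the denominator of \<open>P\<close> and uses
  up one power of q and one sign.\<close>

lemma P_eq:
  assumes "n > 0"
  shows "P n = (\<Sum>m<n. let T = Suc m * (Suc m + 1) div 2 in
    if T \<le> n \<and> Suc m dvd n - T
    then (-1) ^ m * (qvar ^ (n - 1) * sym_sum qvar ((n - T) div Suc m)) else 0)"
proof -
  define S where "S = (\<Sum>m<n. let T = Suc m * (Suc m + 1) div 2 in
      if T \<le> n \<and> Suc m dvd n - T then (-1) ^ Suc m * sym_sum qvar ((n - T) div Suc m) else 0)"
  have "fps_nth gen_prod n = (2 - (qvar + inverse qvar)) * S"
    unfolding gen_prod_nth gen_factor_eq S_def by (rule crank_prod_nth) (use qvar_neq_0_1 assms in auto)
  moreover have "2 - (qvar + inverse qvar) = - (qvar - 1)\<^sup>2 / qvar"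
    using qvar_neq_0_1 by (simp add: field_simps power2_eq_square)
  moreover have "qvar ^ n = qvar * qvar ^ (n - 1)"
    using assms by (cases n) auto
  ultimately have "P n = qvar * qvar ^ (n - 1) * (- (qvar - 1)\<^sup>2 / qvar * S) / (qvar - 1)\<^sup>2"
    unfolding P_def C_def by (simp only:)
  also have "\<dots> = - (qvar ^ (n - 1) * S)"
    using qvar_neq_0_1 by simp
  also have "\<dots> = (\<Sum>m<n. let T = Suc m * (Suc m + 1) div 2 in
    if T \<le> n \<and> Suc m dvd n - T
    then (-1) ^ m * (qvar ^ (n - 1) * sym_sum qvar ((n - T) div Suc m)) else 0)"
    unfolding S_def sum_distrib_left sum_negf[symmetric] Let_def
    by (intro sum.cong refl) (simp add: mult_ac)
  finally show ?thesis .
qed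

lemma power_mult_sym_sum:
  assumes "q \<noteq> 0" "k \<le> N"
  shows "q ^ N * sym_sum q k = q ^ N + (\<Sum>i = 1..k. q ^ (N + i) + q ^ (N - i))"
  using assms(2)
proof (induction k)
  case (Suc k)
  have "q ^ N = q ^ (N - Suc k) * q ^ Suc k"
    using Suc.prems by (metis le_add_diff_inverse2 power_add)
  then have "q ^ N * inverse q ^ Suc k = q ^ (N - Suc k)"
    using assms(1) by (simp add: power_inverse del: power_Suc)
  then show ?case using Suc by (simp add: distrib_left power_add del: power_Suc)
qed simp

lemma is_expansion_crank_coeff:
  assumes "n > 0"
  shows "is_expansion n (crank_coeff n)"
proof -
  \<comment> \<open>\<open>w i\<close> is the palindromic basis element that a_{n,i} multiplies; the
    middle one is a single monomial.\<close>
  define w where "w i = (if i = 0 then qvar ^ (n - 1) else qvar ^ (n + i - 1) + qvar ^ (n - i - 1))" for i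
  define ok where "ok m = (let T = Suc m * (Suc m + 1) div 2 in T \<le> n \<and> Suc m dvd n - T)" for m
  define k where "k m = (let T = Suc m * (Suc m + 1) div 2 in (n - T) div Suc m)" for m
  have k_le: "k m \<le> n - 1" for m
  proof -
    have "k m \<le> n - Suc m * (Suc m + 1) div 2"
      unfolding k_def Let_def by (rule div_le_dividend)
    also have "\<dots> \<le> n - 1" by (rule diff_le_mono2) simp
    finally show ?thesis .
  qed
  have w_sum: "qvar ^ (n - 1) * sym_sum qvar (k m) = (\<Sum>i\<le>n - 1. if i \<le> k m then w i else 0)" for m
  proof -
    have "qvar ^ (n - 1) * sym_sum qvar (k m) = w 0 + (\<Sum>i = 1..k m. w i)"
      unfolding power_mult_sym_sum[OF qvar_neq_0_1(1) k_le] using assms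
      by (simp add: w_def)
    also have "\<dots> = (\<Sum>i\<le>k m. w i)"
      by (simp add: atMost_atLeast0 sum.atLeast_Suc_atMost)
    also have "\<dots> = (\<Sum>i\<le>n - 1. if i \<le> k m then w i else 0)"
      by (rule sum.mono_neutral_cong_left) (use k_le[of m] in auto)
    finally show ?thesis .
  qed
  have "P n = (\<Sum>m<n. if ok m then (-1) ^ m * (qvar ^ (n - 1) * sym_sum qvar (k m)) else 0)"
    unfolding P_eq[OF assms] ok_def k_def Let_def ..
  also have "\<dots> = (\<Sum>m<n. \<Sum>i\<le>n - 1. if ok m \<and> i \<le> k m then (-1) ^ m * w i else 0)"
    unfolding w_sum by (intro sum.cong refl) (simp add: sum_distrib_left if_distrib cong: if_cong)
  also have "\<dots> = (\<Sum>i\<le>n - 1. \<Sum>m<n. if ok m \<and> i \<le> k m then (-1) ^ m * w i else 0)"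
    by (rule sum.swap)
  also have "\<dots> = (\<Sum>i\<le>n - 1. of_int (crank_coeff n i) * w i)"
    unfolding crank_coeff_def ok_def k_def Let_def of_int_sum sum_distrib_right
    by (intro sum.cong refl) simp
  also have "\<dots> = of_int (crank_coeff n 0) * w 0 + (\<Sum>i = 1..n - 1. of_int (crank_coeff n i) * w i)"
    by (simp add: atMost_atLeast0 sum.atLeast_Suc_atMost)
  finally show ?thesis
    unfolding is_expansion_def by (simp add: w_def)
qed

text \<open>Both expansions come from integer polynomials through the injective
  \<open>to_fract\<close>. Only a_{n,i} contributes to q^(n-1+i), since the mirrored monomials have
  degree below n - 1.\<close>

lemma is_expansion_unique:
  assumes "is_expansion n a" "is_expansion n b" "n > 0" "i \<le> n - 1"
  shows "a i = b i"
proof -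
  define p where "p a = monom (a 0) (n - 1) + (\<Sum>j = 1..n - 1. monom (a j) (n + j - 1) + monom (a j) (n - j - 1))"
    for a :: "nat \<Rightarrow> int"
  have mon: "of_int c * qvar ^ k = to_fract (monom c k)" for c k
    by (simp add: of_int_eq_to_fract qvar_power smult_monom flip: to_fract_mult)
  have P: "P n = to_fract (p a)" if "is_expansion n a" for a
    using that unfolding is_expansion_def p_def by (simp add: distrib_left mon)
  have coeff: "coeff (p a) (n - 1 + i) = a i" for a
  proof (cases "i = 0")
    case True
    have "(\<Sum>j = 1..n - 1. coeff (monom (a j) (n + j - 1) + monom (a j) (n - j - 1)) (n - 1)) = 0"
      using assms(3) by (intro sum.neutral) auto
    then show ?thesis using True by (simp add: p_def coeff_sum)
  next
    case False
    have "(\<Sum>j = 1..n - 1. coeff (monom (a j) (n + j - 1) + monom (a j) (n - j - 1)) (n - 1 + i))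
      = (\<Sum>j = 1..n - 1. if j = i then a j else 0)"
      using assms(3) False by (intro sum.cong) auto
    then show ?thesis using False assms(4) by (simp add: p_def coeff_sum)
  qed
  have "p a = p b"
    using P[OF assms(1)] P[OF assms(2)] by simp
  then show ?thesis using coeff by metis
qed

section \<open>Counting divisors\<close>

lemma le_add_sqrt_iff:
  fixes d i n :: nat
  shows "real d \<le> real i + sqrt (2 * real n + (real i)\<^sup>2) \<longleftrightarrow> d * d \<le> 2 * n + 2 * i * d"
proof -
  have "real d \<le> real i + sqrt (2 * real n + (real i)\<^sup>2) \<longleftrightarrow>
      real d - real i \<le> sqrt (2 * real n + (real i)\<^sup>2)"
    by linarith
  also have "\<dots> \<longleftrightarrow> real (d * d) \<le> real (2 * n + 2 * i * d)"
  proof (cases "d \<le> i")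
    case True
    have "real d - real i \<le> sqrt (2 * real n + (real i)\<^sup>2)"
      using True by (smt (verit) of_nat_mono real_sqrt_ge_zero of_nat_0_le_iff zero_le_power2)
    moreover have "d * d \<le> 2 * n + 2 * i * d"
      using mult_right_mono[OF True, of d] by linarith
    ultimately show ?thesis by (metis of_nat_mono)
  next
    case False
    have "real d - real i \<le> sqrt (2 * real n + (real i)\<^sup>2) \<longleftrightarrow>
        (real d - real i)\<^sup>2 \<le> 2 * real n + (real i)\<^sup>2"
      using False by (metis abs_of_nonneg diff_ge_0_iff_ge nat_le_linear of_nat_mono real_sqrt_abs
        real_sqrt_le_iff)
    then show ?thesis by (simp add: power2_eq_square algebra_simps)
  qed
  finally show ?thesis by (simp only: of_nat_le_iff)
qed

lemma half_add_sqrt_less_iff: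
  fixes d i n :: nat
  shows "(real i + sqrt (2 * real n + (real i)\<^sup>2)) / 2 < real d \<longleftrightarrow>
    \<not> (2 * d) * (2 * d) \<le> 2 * n + 2 * i * (2 * d)"
  unfolding le_add_sqrt_iff[symmetric] by auto

text \<open>\<open>L d\<close> stands for d <= X. The left side counts divisors with
  \<open>L d\<close> minus those with \<open>L (2 * d)\<close>. Doubling matches the even ones of
  the first kind with those of the second kind for which \<open>2 * d\<close> divides
  \<open>n\<close>, and these cancel.\<close>

lemma card_divisors_between:
  fixes n :: nat and L :: "nat \<Rightarrow> bool"
  assumes "n > 0" and L: "\<And>d. L (2 * d) \<Longrightarrow> L d"
  shows "int (card {d. d dvd n \<and> \<not> L (2 * d) \<and> L d}) =
    int (card {d. d dvd n \<and> odd d \<and> L d}) - int (card {d. d dvd n \<and> \<not> 2 * d dvd n \<and> L (2 * d)})"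
proof -
  have fin: "finite {d. d dvd n \<and> Q d}" for Q
    using assms(1) by (simp add: finite_divisors_nat)
  have "{d. d dvd n \<and> even d \<and> L d} = (\<lambda>d. 2 * d) ` {d. d dvd n \<and> 2 * d dvd n \<and> L (2 * d)}"
  proof (intro equalityI subsetI)
    fix x assume x: "x \<in> {d. d dvd n \<and> even d \<and> L d}"
    then obtain e where e: "x = 2 * e" by auto
    then have "e \<in> {d. d dvd n \<and> 2 * d dvd n \<and> L (2 * d)}"
      using x by (auto intro: dvd_mult_right)
    then show "x \<in> (\<lambda>d. 2 * d) ` {d. d dvd n \<and> 2 * d dvd n \<and> L (2 * d)}"
      unfolding e by (rule imageI)
  qed (use L in auto)
  then have half: "card {d. d dvd n \<and> even d \<and> L d} = card {d. d dvd n \<and> 2 * d dvd n \<and> L (2 * d)}"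
    by (simp add: card_image inj_on_def)
  have split: "card {d. d dvd n \<and> Q d} = card {d. d dvd n \<and> R d \<and> Q d} + card {d. d dvd n \<and> \<not> R d \<and> Q d}"
    for Q R :: "nat \<Rightarrow> bool"
    by (subst card_Un_disjoint[symmetric]) (auto intro: fin intro!: arg_cong[of _ _ card])
  have "{d. d dvd n \<and> L (2 * d) \<and> L d} = {d. d dvd n \<and> L (2 * d)}"
    using L by auto
  then show ?thesis
    using split[of L "\<lambda>d. L (2 * d)"] split[of L even] split[of "\<lambda>d. L (2 * d)" "\<lambda>d. 2 * d dvd n"] half
    by simp
qed

text \<open>For odd M the equation says n/M = (M + 1)/2 + k, so k >= i means 2(n/M) > M + 2i. The
  other odd divisors M correspond to d = n/M, and 2d <= M + 2i is multiplied by 2d.\<close>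

lemma card_odd_factorizations:
  fixes n i :: nat
  assumes "n > 0"
  shows "card {M. odd M \<and> (\<exists>k\<ge>i. 2 * n = M * (M + 1 + 2 * k))}
    + card {d. d dvd n \<and> \<not> 2 * d dvd n \<and> (2 * d) * (2 * d) \<le> 2 * n + 2 * i * (2 * d)}
    = card {d. d dvd n \<and> odd d}"
proof -
  define B where "B = {M. M dvd n \<and> odd M \<and> 2 * (n div M) \<le> M + 2 * i}"
  have fin: "finite {d. d dvd n \<and> Q d}" for Q
    using assms by (simp add: finite_divisors_nat)
  have V: "{M. odd M \<and> (\<exists>k\<ge>i. 2 * n = M * (M + 1 + 2 * k))} =
      {M. M dvd n \<and> odd M \<and> \<not> 2 * (n div M) \<le> M + 2 * i}"
  proof (intro Collect_cong iffI; elim conjE exE)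
    fix M k assume M: "odd M" and k: "k \<ge> i" "2 * n = M * (M + 1 + 2 * k)"
    obtain j where j: "M = 2 * j + 1" using M by (elim oddE)
    have e: "M + 1 + 2 * k = 2 * (j + 1 + k)" using j by simp
    have "2 * n = 2 * (M * (j + 1 + k))" using k(2) unfolding e by (simp only: mult_ac)
    then have "n = M * (j + 1 + k)" by simp
    moreover have "M > 0" using j by simp
    ultimately have "M dvd n" "n div M = j + 1 + k" by simp_all
    then show "M dvd n \<and> odd M \<and> \<not> 2 * (n div M) \<le> M + 2 * i"
      using M j k(1) by simp
  next
    fix M assume M: "M dvd n" "odd M" "\<not> 2 * (n div M) \<le> M + 2 * i"
    obtain j where j: "M = 2 * j + 1" using M(2) by (elim oddE)
    obtain f where f: "n = M * f" using M(1) by (elim dvdE)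
    have "n div M = f" unfolding f j by (rule nonzero_mult_div_cancel_left) simp
    then have "M + 2 * i < 2 * f" using M(3) by simp
    \<comment> \<open>The witness for \<open>k\<close> solves f = (M + 1)/2 + k with M = 2j +
      1.\<close>
    then have "M + 1 + 2 * (f - j - 1) = 2 * f" "f - j - 1 \<ge> i" using j by auto
    then show "odd M \<and> (\<exists>k\<ge>i. 2 * n = M * (M + 1 + 2 * k))"
      using M(2) f by (metis mult.left_commute)
  qed
  have "bij_betw (\<lambda>d. n div d) {d. d dvd n \<and> \<not> 2 * d dvd n \<and> (2 * d) * (2 * d) \<le> 2 * n + 2 * i * (2 * d)} B"
  proof -
    have "(2 * d) * (2 * d) \<le> 2 * n + 2 * i * (2 * d) \<longleftrightarrow> 2 * d \<le> n div d + 2 * i" if "d dvd n" for d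
    proof -
      obtain M where M: "n = d * M" using \<open>d dvd n\<close> by (elim dvdE)
      have d: "d > 0" using M assms by (cases d) auto
      have "2 * d * (2 * d) = (2 * d) * (2 * d)" "2 * n + 2 * i * (2 * d) = (2 * d) * (M + 2 * i)"
        using M by (simp_all add: algebra_simps)
      then show ?thesis using M d by simp presburger
    qed
    moreover have "\<not> 2 * d dvd n \<longleftrightarrow> odd (n div d)" if "d dvd n" for d
      using that assms by (auto elim!: dvdE)
    ultimately have A: "{d. d dvd n \<and> \<not> 2 * d dvd n \<and> (2 * d) * (2 * d) \<le> 2 * n + 2 * i * (2 * d)}
      = {d. d dvd n \<and> odd (n div d) \<and> 2 * d \<le> n div d + 2 * i}"
      by blast
    show ?thesis unfolding A B_def
      by (rule bij_betw_byWitness[where f' = "\<lambda>d. n div d"]) (use assms in \<open>auto elim!: dvdE\<close>)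
  qed
  then have "card {d. d dvd n \<and> \<not> 2 * d dvd n \<and> (2 * d) * (2 * d) \<le> 2 * n + 2 * i * (2 * d)} = card B"
    by (rule bij_betw_same_card)
  moreover have "card B + card {M. M dvd n \<and> odd M \<and> \<not> 2 * (n div M) \<le> M + 2 * i} = card {d. d dvd n \<and> odd d}"
    unfolding B_def by (subst card_Un_disjoint[symmetric]) (auto intro: fin intro!: arg_cong[of _ _ card])
  ultimately show ?thesis unfolding V by simp
qed

text \<open>For even M the cofactor f = M + 1 + 2k is an odd divisor of \<open>n\<close>, and k >= i
  means f > M + 2i, that is f^2 > 2n + 2if. So M -> 2n/M is a bijection onto the odd divisors
  outside the second set.\<close>

lemma card_even_factorizations:
  fixes n i :: nat
  assumes "n > 0"
  shows "card {M. even M \<and> (\<exists>k\<ge>i. 2 * n = M * (M + 1 + 2 * k))}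
    + card {d. d dvd n \<and> odd d \<and> d * d \<le> 2 * n + 2 * i * d} = card {d. d dvd n \<and> odd d}"
proof -
  let ?A = "{M. even M \<and> (\<exists>k\<ge>i. 2 * n = M * (M + 1 + 2 * k))}"
  let ?B = "{d. d dvd n \<and> odd d \<and> \<not> d * d \<le> 2 * n + 2 * i * d}"
  have fin: "finite {d. d dvd n \<and> Q d}" for Q
    using assms by (simp add: finite_divisors_nat)
  have 1: "2 * n div M \<in> ?B \<and> 2 * n div (2 * n div M) = M" if "M \<in> ?A" for M
  proof -
    obtain k where k: "even M" "k \<ge> i" "2 * n = M * (M + 1 + 2 * k)" using \<open>M \<in> ?A\<close> by blast
    define f where "f = M + 1 + 2 * k"
    have M: "M > 0" using k assms by (cases M) auto
    have Mf: "2 * n = M * f" "f > 0" using k(3) unfolding f_def by simp_all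
    have f: "2 * n div M = f" "2 * n div f = M" using M Mf(2) unfolding Mf(1) by simp_all
    obtain j where j: "M = 2 * j" using k(1) by (elim evenE)
    have n: "n = j * f" "2 * n = f * M" using k(3) j by (auto simp: f_def)
    have "2 * n + 2 * i * f = f * (M + 2 * i)" using n by (simp add: algebra_simps)
    also have "\<dots> < f * f" using k(2) by (intro mult_strict_left_mono) (simp_all add: f_def)
    finally have "\<not> f * f \<le> 2 * n + 2 * i * f" by simp
    moreover have "f dvd n" unfolding n(1) by (rule dvd_triv_right)
    moreover have "odd f" using k(1) by (simp add: f_def)
    ultimately show ?thesis unfolding f by simp
  qed
  have 2: "2 * n div d \<in> ?A \<and> 2 * n div (2 * n div d) = d" if "d \<in> ?B" for d
  proof -
    have d: "d dvd n" "odd d" "\<not> d * d \<le> 2 * n + 2 * i * d" using that by auto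
    obtain j where j: "n = d * j" using d(1) by (elim dvdE)
    have pos: "d > 0" "j > 0" using j assms by auto
    have "2 * n + 2 * i * d = d * (2 * j + 2 * i)" using j by (simp add: algebra_simps)
    then have "d * (2 * j + 2 * i) < d * d" using d(3) by simp
    then have less: "2 * j + 2 * i < d" by simp
    obtain h where h: "d = 2 * h + 1" using d(2) by (elim oddE)
    have "d = 2 * j + 1 + 2 * (h - j)" "h - j \<ge> i" using h less by auto
    moreover have "2 * n div d = 2 * j" using j pos by simp
    moreover have "2 * n = 2 * j * d" using j by simp
    ultimately show ?thesis using pos by auto
  qed
  have "bij_betw (\<lambda>M. 2 * n div M) ?A ?B"
    by (rule bij_betw_byWitness[where f' = "\<lambda>d. 2 * n div d"]) (use 1 2 in blast)+
  then have "card ?A = card ?B"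
    by (rule bij_betw_same_card)
  moreover have "card ?B + card {d. d dvd n \<and> odd d \<and> d * d \<le> 2 * n + 2 * i * d} = card {d. d dvd n \<and> odd d}"
    by (subst card_Un_disjoint[symmetric]) (auto intro: fin intro!: arg_cong[of _ _ card])
  ultimately show ?thesis by simp
qed

lemma crank_coeff_eq_card:
  assumes "n > 0"
  shows "crank_coeff n i = int (card {d. d dvd n \<and>
    \<not> (2 * d) * (2 * d) \<le> 2 * n + 2 * i * (2 * d) \<and> d * d \<le> 2 * n + 2 * i * d})"
proof -
  define V where "V M \<longleftrightarrow> (\<exists>k\<ge>i. 2 * n = M * (M + 1 + 2 * k))" for M
  have le: "M \<in> {0<..n}" if "V M" for M
  proof -
    obtain k where k: "2 * n = M * (M + 1 + 2 * k)" using \<open>V M\<close> unfolding V_def by blast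
    have M: "M > 0" using k assms by (cases M) auto
    \<comment> \<open>The cofactor is at least 2, so M <= n and the finite range of summation misses
      no solution.\<close>
    have "M * 2 \<le> M * (M + 1 + 2 * k)" using M by (intro mult_left_mono) auto
    then have "M \<le> n" unfolding k[symmetric] by linarith
    then show ?thesis using M by simp
  qed
  have fin: "finite {M. Q M \<and> V M}" for Q
    by (rule finite_subset[of _ "{0<..n}"]) (use le in auto)
  \<comment> \<open>For triangular T, doubling n = T + M k gives the factorization of 2n in
    \<open>V\<close>.\<close>
  have V_iff: "T \<le> n \<and> M dvd n - T \<and> i \<le> (n - T) div M \<longleftrightarrow> V M"
    if "T = M * (M + 1) div 2" "M > 0" for M T
  proof -
    have T: "2 * T = M * (M + 1)" using that(1) by simp
    have *: "2 * n = M * (M + 1 + 2 * k) \<longleftrightarrow> n = T + M * k" for k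
      using T by (auto simp: algebra_simps)
    show ?thesis unfolding V_def *
    proof
      assume "T \<le> n \<and> M dvd n - T \<and> i \<le> (n - T) div M"
      then show "\<exists>k\<ge>i. n = T + M * k"
        by (intro exI[of _ "(n - T) div M"]) auto
    qed (use that in auto)
  qed
  have "crank_coeff n i = (\<Sum>m<n. if V (Suc m) then (-1) ^ m else 0)"
    unfolding crank_coeff_def Let_def by (intro sum.cong refl if_cong V_iff) auto
  also have "\<dots> = (\<Sum>M\<in>{0<..n}. if V M then (if odd M then 1 else 0) - (if even M then 1 else 0) else 0)"
    by (rule sum.reindex_bij_witness[of _ "\<lambda>M. M - 1" Suc]) auto
  also have "\<dots> = (\<Sum>M | V M. (if odd M then 1 else 0) - (if even M then 1 else 0))"
    by (rule sum.mono_neutral_cong_right) (use le in auto)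
  also have "\<dots> = int (card {M. odd M \<and> V M}) - int (card {M. even M \<and> V M})"
    using fin[of "\<lambda>_. True"] by (simp add: sum_subtractf sum.If_cases Int_def conj_commute)
  \<comment> \<open>Each count is the number of odd divisors of \<open>n\<close> minus one of these
    cardinalities, so that number cancels.\<close>
  also have "\<dots> = int (card {d. d dvd n \<and> odd d \<and> d * d \<le> 2 * n + 2 * i * d})
      - int (card {d. d dvd n \<and> \<not> 2 * d dvd n \<and> (2 * d) * (2 * d) \<le> 2 * n + 2 * i * (2 * d)})"
    using card_odd_factorizations[OF assms, of i] card_even_factorizations[OF assms, of i]
    unfolding V_def by linarith
  also have "\<dots> = int (card {d. d dvd n \<and>
      \<not> (2 * d) * (2 * d) \<le> 2 * n + 2 * i * (2 * d) \<and> d * d \<le> 2 * n + 2 * i * d})"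
    by (rule card_divisors_between[OF assms, symmetric]) simp
  finally show ?thesis .
qed

theorem theorem1p2:
  fixes n :: nat
  assumes "n \<ge> 1"
  shows "(\<exists>a. is_expansion n a) \<and>
    (\<forall>a. is_expansion n a \<longrightarrow>
      (\<forall>i \<le> n - 1. a i = int (card {d::nat. d > 0 \<and> d dvd n \<and>
          (real i + sqrt (2 * real n + (real i)\<^sup>2)) / 2 < real d \<and>
          real d \<le> real i + sqrt (2 * real n + (real i)\<^sup>2)})))"
proof (intro conjI allI impI)
  have n: "n > 0" using assms by simp
  show "\<exists>a. is_expansion n a"
    using is_expansion_crank_coeff[OF n] by blast
  fix a i assume a: "is_expansion n a" and i: "i \<le> n - 1"
  have "a i = crank_coeff n i"
    by (rule is_expansion_unique[OF a is_expansion_crank_coeff[OF n] n i])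
  then show "a i = int (card {d::nat. d > 0 \<and> d dvd n \<and>
          (real i + sqrt (2 * real n + (real i)\<^sup>2)) / 2 < real d \<and>
          real d \<le> real i + sqrt (2 * real n + (real i)\<^sup>2)})"
    unfolding crank_coeff_eq_card[OF n] half_add_sqrt_less_iff le_add_sqrt_iff
    using n by (simp add: dvd_pos_nat cong: conj_cong) (metis dvd_pos_nat)
qed

end
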